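(* Let $n\ge 2$ be an integer and let $0<\gamma<1$. For an integer $\ell\ge -n$ put $B_{n,\ell}(t)=B_n(t-\ell)$, $t\ge 0$, where $B_n$ is the cardinal B-spline of degree $n$. Then for all $t>0$ the Caputo fractional derivative of order $\gamma$ of $B_{n,\ell}$ is given by $$D_t^{\gamma}B_{n,\ell}(t)=\frac{1}{\Gamma(n-\gamma+1)}\,\bigl(\Delta^{n+1}T_{n-\gamma}\bigr)(t-\ell)\qquad\text{if } \ell\ge 0,$$ and $$D_t^{\gamma}B_{n,\ell}(t)=\frac{\bigl(\Delta^{n+1}T_{n-\gamma}\bigr)(t-\ell)}{\Gamma(n+1-\gamma)}-\frac{1}{\Gamma(1-\gamma)}\int_0^{-\ell}\frac{B_n'(\tau)}{(t-\ell-\tau)^{\gamma}}\,d\tau\qquad\text{if } -n\le\ell\le -1.$$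
   Context: For real $\alpha\ge 0$, the (fractional) truncated power function is $T_\alpha(t)=(\max(0,t))^\alpha$, $t\in\mathbb R$. The backward finite difference operator is $\Delta^{N}f(t)=\sum_{r=0}^{N}\binom{N}{r}(-1)^r f(t-r)$ for $N\in\mathbb N$. The cardinal B-spline of integer degree $n$ is $B_n(t)=\frac{1}{n!}\Delta^{n+1}T_n(t)$; it is a piecewise polynomial of degree $n$ with breakpoints on the integers, supported on $[0,n+1]$ and of class $C^{n-1}$. For $0<\gamma<1$ the Caputo fractional derivative of a sufficiently smooth function $x$ on $[0,\infty)$ is $$D_t^\gamma x(t)=\frac{1}{\Gamma(1-\gamma)}\int_0^t\frac{x'(\tau)}{(t-\tau)^{\gamma}}\,d\tau,\qquad t>0,$$ where $\Gamma$ is Euler's gamma function. *)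

theory Defs
  imports "HOL-Analysis.Analysis"
begin

(* As 0 powr \<alpha> = 0 for every \<alpha>, the convention at \<alpha> = 0 is T_0(t) = 0 for t \<le> 0 and
   T_0(t) = 1 for t > 0. *)
definition trunc_pow :: "real \<Rightarrow> real \<Rightarrow> real" where
  "trunc_pow \<alpha> t = (max 0 t) powr \<alpha>"

definition bdiff :: "nat \<Rightarrow> (real \<Rightarrow> real) \<Rightarrow> real \<Rightarrow> real" where
  "bdiff N f t = (\<Sum>r=0..N. real (N choose r) * (-1) ^ r * f (t - real r))"

definition bspline :: "nat \<Rightarrow> real \<Rightarrow> real" where
  "bspline n t = 1 / fact n * bdiff (n + 1) (trunc_pow (real n)) t"

definition bspline_shift :: "nat \<Rightarrow> int \<Rightarrow> real \<Rightarrow> real" where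
  "bspline_shift n l t = bspline n (t - of_int l)"

(* Functions on [0,\<infinity>) are represented by functions on all of \<real>. Only values on (0,\<infinity>) matter:
   the two-sided derivative at \<tau> = 0, the only point where other values enter, concerns a null set.
   At \<tau> = t the integrand is 0 by the convention x / 0 = 0. *)
definition caputo_integrand :: "real \<Rightarrow> (real \<Rightarrow> real) \<Rightarrow> real \<Rightarrow> real \<Rightarrow> real" where
  "caputo_integrand \<gamma> x t \<tau> = deriv x \<tau> / (t - \<tau>) powr \<gamma>"

(* The integral below is 0 by convention when it does not exist; under this predicate it exists
   and is the Lebesgue integral. *)
definition caputo_exists :: "real \<Rightarrow> (real \<Rightarrow> real) \<Rightarrow> real \<Rightarrow> bool" where
  "caputo_exists \<gamma> x t \<longleftrightarrow> caputo_integrand \<gamma> x t absolutely_integrable_on {0..t}"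

definition caputo :: "real \<Rightarrow> (real \<Rightarrow> real) \<Rightarrow> real \<Rightarrow> real" where
  "caputo \<gamma> x t = 1 / Gamma (1 - \<gamma>) * integral {0..t} (caputo_integrand \<gamma> x t)"

end

theory Submission
  imports Defs
begin

text \<open>
  For an exponent above 1 the truncated power is differentiable everywhere, so at every
  point, knots included, \<open>B\<^sub>n'\<close> is \<open>n / n!\<close> times the same backward difference applied to
  \<open>T\<^bsub>n-1\<^esub>\<close>. The Caputo kernel \<open>(s - \<tau>)\<^bsup>-\<gamma>\<^esup>\<close> is itself a truncated power
  \<open>T\<^bsub>-\<gamma>\<^esub>(s - \<tau>)\<close>, and the truncated powers are closed under convolution: by
  Euler's Beta integral, \<open>T\<^sub>p * T\<^sub>q = Beta (p + 1) (q + 1) T\<^bsub>p+q+1\<^esub>\<close> for \<open>p, q > -1\<close>. Every knot \<open>r\<close> of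
  \<open>B\<^sub>n\<close> is nonnegative, so an interval \<open>{a..s}\<close> with \<open>a \<le> 0\<close> contains the whole support of each
  convolution integrand, and integrating term by term gives
  \<open>\<integral> B\<^sub>n'(\<tau>) (s - \<tau>)\<^bsup>-\<gamma>\<^esup> d\<tau> = \<Gamma>(1 - \<gamma>) / \<Gamma>(n + 1 - \<gamma>) \<Delta>\<^bsup>n+1\<^esup> T\<^bsub>n-\<gamma>\<^esub>(s)\<close>
  over \<open>{a..s}\<close>; the Gamma factors are what remains of \<open>n / n! \<cdot> Beta n (1 - \<gamma>)\<close>.

  Substituting \<open>\<sigma> = \<tau> - l\<close> turns the Caputo integral of the shifted spline into the integral of
  this integrand over \<open>{-l..s}\<close> with \<open>s = t - l\<close>. If \<open>l \<ge> 0\<close> the lower end \<open>-l\<close> is an admissible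
  \<open>a\<close>. If \<open>l < 0\<close> the interval is \<open>{0..s}\<close> without its initial piece \<open>{0..-l}\<close>, whence
  the correction integral.
\<close>

lemma trunc_pow_nonneg: "0 \<le> trunc_pow \<alpha> x"
  by (simp add: trunc_pow_def)

lemma trunc_pow_nonpos: "x \<le> 0 \<Longrightarrow> trunc_pow \<alpha> x = 0"
  by (simp add: trunc_pow_def)

lemma trunc_pow_of_nonneg: "x \<ge> 0 \<Longrightarrow> trunc_pow \<alpha> x = x powr \<alpha>"
  by (simp add: trunc_pow_def)

lemma trunc_pow_uminus: "x \<ge> 0 \<Longrightarrow> trunc_pow (- \<alpha>) x = 1 / x powr \<alpha>"
  by (simp add: trunc_pow_def powr_minus_divide)

text \<open>
  Only the origin needs an argument: there the difference quotient is bounded by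
  \<open>\<bar>h\<bar>\<^bsup>\<alpha>-1\<^esup>\<close>, which tends to 0 because \<open>\<alpha> > 1\<close>.
\<close>

lemma has_real_derivative_trunc_pow:
  fixes \<alpha> x :: real
  assumes "\<alpha> > 1"
  shows "(trunc_pow \<alpha> has_real_derivative \<alpha> * trunc_pow (\<alpha> - 1) x) (at x)"
proof -
  consider "x > 0" | "x < 0" | "x = 0" by linarith
  then show ?thesis
  proof cases
    case 1
    have "((\<lambda>y. y powr \<alpha>) has_real_derivative \<alpha> * trunc_pow (\<alpha> - 1) x) (at x)"
      using has_real_derivative_powr[OF 1] 1 by (simp add: trunc_pow_of_nonneg)
    then show ?thesis
      by (rule has_field_derivative_transform_within_open[where S = "{0<..}"])
         (use 1 in \<open>auto simp: trunc_pow_of_nonneg\<close>)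
  next
    case 2
    have "((\<lambda>y. 0) has_real_derivative \<alpha> * trunc_pow (\<alpha> - 1) x) (at x)"
      using 2 by (simp add: trunc_pow_nonpos)
    then show ?thesis
      by (rule has_field_derivative_transform_within_open[where S = "{..<0}"])
         (use 2 in \<open>auto simp: trunc_pow_nonpos\<close>)
  next
    case 3
    have lim: "((\<lambda>h::real. \<bar>h\<bar> powr (\<alpha> - 1)) \<longlongrightarrow> 0) (at 0)"
      by (rule tendsto_zero_powrI[where b = "\<alpha> - 1"])
         (use assms in \<open>auto intro!: tendsto_eq_intros\<close>)
    have bound: "norm (trunc_pow \<alpha> h / h) \<le> \<bar>h\<bar> powr (\<alpha> - 1)" for h :: real
    proof (cases "h > 0")
      case True
      then show ?thesis by (simp add: trunc_pow_of_nonneg powr_diff)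
    next
      case False
      then show ?thesis by (simp add: trunc_pow_nonpos)
    qed
    have "((\<lambda>h. trunc_pow \<alpha> h / h) \<longlongrightarrow> 0) (at 0)"
      by (rule Lim_null_comparison[OF always_eventually lim]) (rule allI, rule bound)
    then show ?thesis
      by (simp add: 3 DERIV_def trunc_pow_nonpos)
  qed
qed

text \<open>
  On \<open>{r..s}\<close> this is Euler's Beta integral rescaled to an interval of length \<open>s - r\<close>; outside
  \<open>{r..s}\<close> the product vanishes.
\<close>

lemma has_integral_trunc_pow_convolution:
  fixes p q a r s :: real
  assumes "p > -1" "q > -1" "a \<le> r"
  shows "((\<lambda>\<tau>. trunc_pow p (\<tau> - r) * trunc_pow q (s - \<tau>)) has_integral
           Beta (p + 1) (q + 1) * trunc_pow (p + q + 1) (s - r)) {a..s}"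
proof (cases "r < s")
  case False
  have "((\<lambda>\<tau>. trunc_pow p (\<tau> - r) * trunc_pow q (s - \<tau>)) has_integral 0) {a..s}"
  proof (rule has_integral_is_0)
    show "trunc_pow p (\<tau> - r) * trunc_pow q (s - \<tau>) = 0" for \<tau>
      using False by (cases "\<tau> \<le> r") (auto simp: trunc_pow_nonpos)
  qed
  then show ?thesis
    using False by (simp add: trunc_pow_nonpos)
next
  case True
  define d where "d = s - r"
  have d: "d > 0" using True by (simp add: d_def)
  let ?g = "\<lambda>u::real. u powr p * (1 - u) powr q"
  have "(?g has_integral Beta (p + 1) (q + 1)) (cbox 0 1)"
    using has_integral_Beta_real[of "p + 1" "q + 1"] assms by simp
  from has_integral_affinity'[OF this, of "1 / d" "- r / d"] d
  have "((\<lambda>\<tau>. ?g ((1 / d) *\<^sub>R \<tau> + - r / d)) has_integral Beta (p + 1) (q + 1) /\<^sub>R (1 / d))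
      (cbox ((0 - - r / d) /\<^sub>R (1 / d)) ((1 - - r / d) /\<^sub>R (1 / d)))"
    by simp
  moreover have "(0 - - r / d) /\<^sub>R (1 / d) = r"
    using d by simp
  moreover have "(1 - - r / d) /\<^sub>R (1 / d) = s"
  proof -
    have "(1 - - r / d) /\<^sub>R (1 / d) = d + r"
      using d by (simp add: distrib_left)
    then show ?thesis by (simp add: d_def)
  qed
  moreover have "(1 / d) *\<^sub>R \<tau> + - r / d = (\<tau> - r) / d" for \<tau>
    by (simp add: diff_divide_distrib)
  moreover have "Beta (p + 1) (q + 1) /\<^sub>R (1 / d) = Beta (p + 1) (q + 1) * d"
    by simp
  ultimately have "((\<lambda>\<tau>. ?g ((\<tau> - r) / d)) has_integral Beta (p + 1) (q + 1) * d) {r..s}"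
    by (simp only: cbox_interval)
  then have "((\<lambda>\<tau>. d powr (p + q) * ?g ((\<tau> - r) / d)) has_integral
      d powr (p + q) * (Beta (p + 1) (q + 1) * d)) {r..s}"
    by (rule has_integral_mult_right)
  moreover have "d powr (p + q) * (Beta (p + 1) (q + 1) * d) =
      Beta (p + 1) (q + 1) * trunc_pow (p + q + 1) (s - r)"
    using d powr_add[of d "p + q" 1] by (simp add: trunc_pow_of_nonneg d_def)
  ultimately have "((\<lambda>\<tau>. d powr (p + q) * ?g ((\<tau> - r) / d)) has_integral
      Beta (p + 1) (q + 1) * trunc_pow (p + q + 1) (s - r)) {r..s}"
    by (simp only:)
  moreover have "d powr (p + q) * ?g ((\<tau> - r) / d) =
      trunc_pow p (\<tau> - r) * trunc_pow q (s - \<tau>)" if "\<tau> \<in> {r..s}" for \<tau>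
  proof -
    have "1 - (\<tau> - r) / d = (d - (\<tau> - r)) / d"
      using d by (simp add: diff_divide_distrib)
    also have "\<dots> = (s - \<tau>) / d"
      by (simp add: d_def)
    finally have "1 - (\<tau> - r) / d = (s - \<tau>) / d" .
    then show ?thesis
      using that d by (simp add: trunc_pow_of_nonneg powr_divide powr_add)
  qed
  ultimately have "((\<lambda>\<tau>. trunc_pow p (\<tau> - r) * trunc_pow q (s - \<tau>)) has_integral
      Beta (p + 1) (q + 1) * trunc_pow (p + q + 1) (s - r)) {r..s}"
    by (rule has_integral_eq[rotated])
  then show ?thesis
  proof (rule has_integral_on_superset)
    show "trunc_pow p (\<tau> - r) * trunc_pow q (s - \<tau>) = 0" if "\<tau> \<notin> {r..s}" for \<tau>
      using that by (cases "\<tau> \<le> r") (simp_all add: trunc_pow_nonpos)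
    show "{r..s} \<subseteq> {a..s}" using assms(3) by simp
  qed
qed

text \<open>The bound \<open>n \<ge> 2\<close> puts the exponent above 1, so the formula holds at the knots as well.\<close>

lemma deriv_bspline:
  assumes "n \<ge> 2"
  shows "deriv (bspline n) x = real n / fact n * bdiff (n + 1) (trunc_pow (real n - 1)) x"
proof (rule DERIV_imp_deriv)
  let ?T' = "trunc_pow (real n - 1)"
  have T: "((\<lambda>y. trunc_pow (real n) (y - real r)) has_real_derivative real n * ?T' (x - real r)) (at x)"
    for r
    using has_real_derivative_trunc_pow[of "real n" "x - real r"] assms
      DERIV_shift[of "trunc_pow (real n)" _ x "- real r"] by simp
  have "((\<lambda>y. 1 / fact n * (\<Sum>r=0..n + 1. real (n + 1 choose r) * (-1) ^ r * trunc_pow (real n) (y - real r)))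
      has_real_derivative
      1 / fact n * (\<Sum>r=0..n + 1. real (n + 1 choose r) * (-1) ^ r * (real n * ?T' (x - real r)))) (at x)"
    by (intro DERIV_cmult DERIV_sum T)
  moreover have "1 / fact n * (\<Sum>r=0..n + 1. real (n + 1 choose r) * (-1) ^ r * (real n * ?T' (x - real r))) =
      real n / fact n * bdiff (n + 1) ?T' x"
    unfolding bdiff_def sum_distrib_left by (rule sum.cong) simp_all
  ultimately show "(bspline n has_real_derivative real n / fact n * bdiff (n + 1) ?T' x) (at x)"
    unfolding bspline_def[abs_def] bdiff_def by simp
qed

lemma Beta_bspline_coefficient:
  assumes "n \<ge> 1"
  shows "real n / fact n * Beta (real n) (1 - \<gamma>) = Gamma (1 - \<gamma>) / Gamma (real n + 1 - \<gamma>)"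
proof -
  have "real n * Gamma (real n) = Gamma (real n + 1)"
    using assms Gamma_plus1[of "real n"] by (simp add: of_nat_in_nonpos_Ints_iff)
  also have "\<dots> = fact n"
    using Gamma_fact[of n, where 'a = real] by (simp add: add.commute)
  finally have *: "real n * Gamma (real n) = fact n" .
  have "real n / fact n * Beta (real n) (1 - \<gamma>) =
      (real n * Gamma (real n)) / fact n * (Gamma (1 - \<gamma>) / Gamma (real n + 1 - \<gamma>))"
    by (simp add: Beta_def add_diff_eq mult.assoc)
  then show ?thesis
    by (simp only: *) simp
qed

text \<open>
  Term by term this is the convolution of \<open>T\<^bsub>n-1\<^esub>(\<tau> - r)\<close> with \<open>T\<^bsub>-\<gamma>\<^esub>\<close>. Each of these
  products is nonnegative, so its integrability is already absolute, and the finite linear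
  combination inherits that.
\<close>

lemma bspline_kernel_integral:
  fixes \<gamma> a s :: real
  assumes n: "n \<ge> 2" and \<gamma>: "\<gamma> < 1" and a: "a \<le> 0"
  defines "K \<equiv> \<lambda>\<tau>. deriv (bspline n) \<tau> / (s - \<tau>) powr \<gamma>"
  shows absolutely_integrable_bspline_kernel: "K absolutely_integrable_on {a..s}"
    and has_integral_bspline_kernel: "(K has_integral Gamma (1 - \<gamma>) / Gamma (real n + 1 - \<gamma>) *
           bdiff (n + 1) (trunc_pow (real n - \<gamma>)) s) {a..s}"
proof -
  define c where "c r = real n / fact n * (real (n + 1 choose r) * (-1) ^ r)" for r
  let ?f = "\<lambda>r \<tau>. trunc_pow (real n - 1) (\<tau> - real r) * trunc_pow (- \<gamma>) (s - \<tau>)"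
  have K: "K \<tau> = (\<Sum>r=0..n + 1. c r * ?f r \<tau>)" if "\<tau> \<in> {a..s}" for \<tau>
    using that trunc_pow_uminus[of "s - \<tau>" \<gamma>]
    by (simp add: K_def deriv_bspline[OF n] bdiff_def c_def sum_distrib_left sum_divide_distrib
        mult_ac del: sum.cl_ivl_Suc)
  have f: "(?f r has_integral Beta (real n) (1 - \<gamma>) * trunc_pow (real n - \<gamma>) (s - real r)) {a..s}" for r
    using has_integral_trunc_pow_convolution[of "real n - 1" "- \<gamma>" a "real r" s] n \<gamma> a by simp
  have "?f r absolutely_integrable_on {a..s}" for r
    using f[of r] by (intro nonnegative_absolutely_integrable_1)
      (auto simp: has_integral_integrable trunc_pow_nonneg)
  then have "(\<lambda>\<tau>. \<Sum>r=0..n + 1. c r * ?f r \<tau>) absolutely_integrable_on {a..s}"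
    by (intro absolutely_integrable_sum set_integrable_mult_right) auto
  then show "K absolutely_integrable_on {a..s}"
    by (rule absolutely_integrable_spike[OF _ negligible_empty]) (use K in auto)
  have "((\<lambda>\<tau>. \<Sum>r=0..n + 1. c r * ?f r \<tau>) has_integral
      (\<Sum>r=0..n + 1. c r * (Beta (real n) (1 - \<gamma>) * trunc_pow (real n - \<gamma>) (s - real r)))) {a..s}"
    by (intro has_integral_sum has_integral_mult_right f) auto
  moreover have "(\<Sum>r=0..n + 1. c r * (Beta (real n) (1 - \<gamma>) * trunc_pow (real n - \<gamma>) (s - real r))) =
      (real n / fact n * Beta (real n) (1 - \<gamma>)) * bdiff (n + 1) (trunc_pow (real n - \<gamma>)) s"
    by (simp add: c_def bdiff_def sum_distrib_left mult_ac del: sum.cl_ivl_Suc)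
  ultimately have "((\<lambda>\<tau>. \<Sum>r=0..n + 1. c r * ?f r \<tau>) has_integral
      Gamma (1 - \<gamma>) / Gamma (real n + 1 - \<gamma>) * bdiff (n + 1) (trunc_pow (real n - \<gamma>)) s) {a..s}"
    using Beta_bspline_coefficient[of n \<gamma>] n by (simp only:)
  then show "(K has_integral Gamma (1 - \<gamma>) / Gamma (real n + 1 - \<gamma>) *
      bdiff (n + 1) (trunc_pow (real n - \<gamma>)) s) {a..s}"
    by (rule has_integral_eq[rotated]) (simp only: K)
qed

lemma deriv_bspline_shift:
  "deriv (bspline_shift n l) \<tau> = deriv (bspline n) (\<tau> - of_int l)"
  by (simp add: deriv_def bspline_shift_def[abs_def]
      DERIV_shift[of "bspline n" _ \<tau> "- of_int l", simplified])

lemma caputo_integrand_bspline_shift: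
  "caputo_integrand \<gamma> (bspline_shift n l) t =
     (\<lambda>\<tau>. (\<lambda>\<sigma>. deriv (bspline n) \<sigma> / (t - of_int l - \<sigma>) powr \<gamma>) (\<tau> + - of_int l))"
  by (simp add: caputo_integrand_def[abs_def] deriv_bspline_shift)

lemma absolutely_integrable_shift_real_ivl:
  fixes f :: "real \<Rightarrow> real"
  assumes "f absolutely_integrable_on {a + c..b + c}"
  shows "(\<lambda>x. f (x + c)) absolutely_integrable_on {a..b}"
proof -
  have "(\<lambda>x. g (x + c)) integrable_on {a..b}" if "g integrable_on {a + c..b + c}" for g :: "real \<Rightarrow> real"
    using integrable_shift_real_ivl[OF that, of c] by simp
  then show ?thesis
    using assms by (auto simp: absolutely_integrable_on_def)
qed

theorem theorem3p1:
  fixes n :: nat and \<gamma> t :: real and l :: int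
  assumes "n \<ge> 2" and "0 < \<gamma>" and "\<gamma> < 1" and "l \<ge> - int n" and "t > 0"
  shows "caputo_exists \<gamma> (bspline_shift n l) t \<and>
    (l \<ge> 0 \<longrightarrow>
      caputo \<gamma> (bspline_shift n l) t =
        1 / Gamma (real n - \<gamma> + 1) * bdiff (n + 1) (trunc_pow (real n - \<gamma>)) (t - of_int l)) \<and>
    (- int n \<le> l \<and> l \<le> -1 \<longrightarrow>
      caputo \<gamma> (bspline_shift n l) t =
        bdiff (n + 1) (trunc_pow (real n - \<gamma>)) (t - of_int l) / Gamma (real n + 1 - \<gamma>)
        - 1 / Gamma (1 - \<gamma>) *
          integral {0..- of_int l} (\<lambda>\<tau>. deriv (bspline n) \<tau> / (t - of_int l - \<tau>) powr \<gamma>))"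
proof -
  define s where "s = t - of_int l"
  define K where "K = (\<lambda>\<tau>. deriv (bspline n) \<tau> / (s - \<tau>) powr \<gamma>)"
  define D where "D = bdiff (n + 1) (trunc_pow (real n - \<gamma>)) s"
  \<comment> \<open>For either sign of \<open>l\<close> the interval \<open>{a..s}\<close> contains \<open>{-l..s}\<close> and starts at or before the first knot 0.\<close>
  define a :: real where "a = min 0 (- of_int l)"
  note kernel = absolutely_integrable_bspline_kernel[OF assms(1,3), where s = s, folded K_def]
    has_integral_bspline_kernel[OF assms(1,3), where s = s, folded K_def D_def]
  have integrand: "caputo_integrand \<gamma> (bspline_shift n l) t = (\<lambda>\<tau>. K (\<tau> + - of_int l))"
    by (simp add: caputo_integrand_bspline_shift K_def s_def)
  have "K absolutely_integrable_on {- of_int l..s}"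
    using kernel(1)[of a]
    by (rule absolutely_integrable_on_subinterval) (auto simp: a_def)
  then have ex: "caputo_exists \<gamma> (bspline_shift n l) t"
    unfolding caputo_exists_def integrand
    by (intro absolutely_integrable_shift_real_ivl) (simp add: s_def)
  have cap: "caputo \<gamma> (bspline_shift n l) t = 1 / Gamma (1 - \<gamma>) * integral {- of_int l..s} K"
    using integral_shift_real_ivl[of "- of_int l" "- of_int l" s K]
    by (simp add: caputo_def integrand s_def)
  have \<Gamma>: "Gamma (1 - \<gamma>) \<noteq> 0"
    using Gamma_real_pos[of "1 - \<gamma>"] assms(3) by linarith
  have pos: "caputo \<gamma> (bspline_shift n l) t = 1 / Gamma (real n - \<gamma> + 1) * D" if "l \<ge> 0"
    using integral_unique[OF kernel(2)[of "- of_int l"]] that \<Gamma>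
    by (simp add: cap algebra_simps)
  have neg: "caputo \<gamma> (bspline_shift n l) t =
      D / Gamma (real n + 1 - \<gamma>) - 1 / Gamma (1 - \<gamma>) * integral {0..- of_int l} K" if "l \<le> -1"
  proof -
    have "integral {0..- of_int l} K + integral {- of_int l..s} K = integral {0..s} K"
      using that \<open>t > 0\<close> kernel(2)[of 0]
      by (intro Henstock_Kurzweil_Integration.integral_combine)
         (auto simp: s_def has_integral_integrable)
    also have "\<dots> = Gamma (1 - \<gamma>) / Gamma (real n + 1 - \<gamma>) * D"
      using integral_unique[OF kernel(2)[of 0]] by simp
    finally have "integral {- of_int l..s} K =
        Gamma (1 - \<gamma>) / Gamma (real n + 1 - \<gamma>) * D - integral {0..- of_int l} K" by simp
    then show ?thesis
      using \<Gamma> by (simp add: cap right_diff_distrib)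
  qed
  from ex pos neg show ?thesis
    by (auto simp: D_def K_def s_def)
qed

end
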